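(* For integers $n\ge 1$ and $k\ge 0$, let $CT(n,k)$ be the number of set partitions of $[n]$ with exactly $k$ arcs that contain no right crossings. Then, as formal power series in $x$ and $y$, $$\sum_{n\geq 1}\sum_{k=0}^{n-1}CT(n,k)\,x^n y^k=\sum_{n\geq 1}\frac{x^n(1+xy)^{\binom{n}{2}}}{\prod_{k=0}^{n-1}\bigl(1-(1+xy)^k xy\bigr)}.$$
   Context: $[n]=\{1,2,\ldots,n\}$. The arcs of a set partition $\pi$ of $[n]$ are those of its linear representation: for each block $\{i_1<i_2<\cdots<i_r\}$ of $\pi$, the arcs are the pairs $(i_1,i_2),(i_2,i_3),\ldots,(i_{r-1},i_r)$ of consecutive elements of the block (a singleton block gives no arc). A right crossing of $\pi$ is a pair of arcs $(i_1,j_1)$, $(i_2,j_2)$ of $\pi$ with $i_1<i_2<j_1<j_2$ and $j_2=j_1+1$. *)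

theory Defs
  imports
    "HOL-Analysis.Infinite_Sum"
    "HOL-Library.Disjoint_Sets"
    "HOL-Computational_Algebra.Formal_Power_Series"
begin

definition arcs :: "nat set set \<Rightarrow> (nat \<times> nat) set" where
  "arcs P = {(i, j). \<exists>B\<in>P. i \<in> B \<and> j \<in> B \<and> i < j \<and> (\<forall>m\<in>B. \<not> (i < m \<and> m < j))}"

definition has_right_crossing :: "nat set set \<Rightarrow> bool" where
  "has_right_crossing P \<longleftrightarrow>
     (\<exists>i1 j1 i2 j2. (i1, j1) \<in> arcs P \<and> (i2, j2) \<in> arcs P \<and>
        i1 < i2 \<and> i2 < j1 \<and> j1 < j2 \<and> j2 = j1 + 1)"

definition CT :: "nat \<Rightarrow> nat \<Rightarrow> nat" where
  "CT n k = card {P. partition_on {1..n} P \<and> card (arcs P) = k \<and> \<not> has_right_crossing P}"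

(* Bivariate formal power series in x and y are taken as power series in x over the ring of
   power series in y.  Infinite sums refer to the library topology on fps, which here is the
   x-adic one.  The ground field is rat rather than int because division on fps needs an
   inverse operation on coefficients. *)

abbreviation fps_x :: "rat fps fps" where
  "fps_x \<equiv> fps_X"

abbreviation fps_y :: "rat fps fps" where
  "fps_y \<equiv> fps_const fps_X"

(* The library's inverse is a genuine inverse only for suitable series (it is defined through
   the inverse of the lowest coefficient, itself a series in y); a denominator with constant
   coefficient 1 in x is such a case. *)

lemma divide_times_cancel_const_one:
  fixes f g :: "rat fps fps"
  assumes "fps_nth g 0 = 1"
  shows "f / g * g = f"
proof -
  have "fps_nth g 0 * inverse (fps_nth g 0) = 1"
    using assms by (simp add: inverse_mult_eq_1')
  then have "g * inverse g = 1"
    unfolding fps_inverse_def by (rule fps_right_inverse)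
  moreover have "subdegree g = 0"
    using assms by (simp add: subdegree_eq_0_iff)
  moreover have "f / g = f * inverse g"
    using \<open>subdegree g = 0\<close> by (simp add: fps_divide_def)
  ultimately show ?thesis
    by (simp add: mult.assoc mult.commute[of "inverse g"])
qed

lemma denominator_const_one:
  "fps_nth (\<Prod>k=0..n-1. (1 - (1 + fps_x * fps_y) ^ k * (fps_x * fps_y))) 0 = 1"
proof -
  have "fps_nth (\<Prod>k\<in>A. (1 - (1 + fps_x * fps_y) ^ k * (fps_x * fps_y))) 0 = 1"
    if "finite A" for A
    using that by (induction A) auto
  then show ?thesis by simp
qed

end

(* Build a partition of {1..n} point by point. Order the blocks by decreasing maximum. Appending
   n+1 to the block of rank q creates a right crossing iff 0 < q <= p, where p is the rank at which n
   was appended (0 if n opened a new block or joined the block of n-1). Hence, with u = xy and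
   S b q the generating function of the crossing-free partitions with b blocks and p < q,
   S b (q+1) = (1+u) (S b q) for 0 < q < b and S (b+1) 1 = x (G b) + u (G (b+1)), where
   G b = S b b. So G (b+1) (1 - (1+u)^b u) = x (1+u)^b (G b), and G b is the b-th term of the
   right-hand series. *)

theory Submission
  imports Defs
begin

section \<open>Appending a point to a set partition\<close>

text \<open>The choice B = {} makes the new point a singleton block.\<close>

definition append_point :: "nat \<Rightarrow> nat set set \<Rightarrow> nat set \<Rightarrow> nat set set" where
  "append_point n P B = insert (insert (Suc n) B) (P - {B})"

lemma arcs_insert: "arcs (insert B P) = arcs {B} \<union> arcs P"
  by (auto simp: arcs_def)

lemma arcs_empty [simp]: "arcs {} = {}" "arcs {{}} = {}"
  by (auto simp: arcs_def)

lemma arcs_split: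
  assumes "B \<in> insert {} P"
  shows "arcs P = arcs {B} \<union> arcs (P - {B})"
proof (cases "B \<in> P")
  case True
  then show ?thesis using arcs_insert[of B "P - {B}"] by (simp add: insert_absorb)
next
  case False
  then show ?thesis using assms by simp
qed

lemma partition_on_atLeastAtMostD:
  fixes n :: nat
  assumes "partition_on {1..n} P"
  shows "finite P" "B \<in> P \<Longrightarrow> finite B" "B \<in> P \<Longrightarrow> B \<noteq> {}" "B \<in> P \<Longrightarrow> B \<subseteq> {1..n}"
    "B \<in> P \<Longrightarrow> Max B \<in> B" "B \<in> P \<Longrightarrow> Suc n \<notin> B" "{} \<notin> P"
proof -
  show "finite P" using assms by (rule finite_elements[rotated]) simp
  have *: "B \<subseteq> {1..n}" "B \<noteq> {}" if "B \<in> P" for B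
    using assms that by (auto simp: partition_on_def)
  show "{} \<notin> P" using *(2) by blast
  show fin: "finite B" if "B \<in> P" for B using *[OF that] finite_subset by blast
  show "B \<in> P \<Longrightarrow> Max B \<in> B" using fin * Max_in by blast
  show "B \<in> P \<Longrightarrow> B \<noteq> {}" "B \<in> P \<Longrightarrow> B \<subseteq> {1..n}" "B \<in> P \<Longrightarrow> Suc n \<notin> B" using * by force+
qed

lemma partition_on_same_block:
  assumes "partition_on A P" "B \<in> P" "C \<in> P" "x \<in> B" "x \<in> C"
  shows "B = C"
  using assms unfolding partition_on_def disjoint_def by blast

lemma partition_on_append_point:
  assumes "partition_on {1..n} P" "B \<in> insert {} P"
  shows "partition_on {1..Suc n} (append_point n P B)"
proof (rule partition_onI)
  have U: "\<Union>P = {1..n}" using assms by (simp add: partition_on_def)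
  have "\<Union>(append_point n P B) = insert (Suc n) (\<Union>P)"
    using assms(2) by (auto simp: append_point_def)
  also have "\<dots> = {1..Suc n}" using U by auto
  finally show "\<Union>(append_point n P B) = {1..Suc n}" .
  show "{} \<notin> append_point n P B"
    using partition_on_atLeastAtMostD(7)[OF assms(1)] by (auto simp: append_point_def)
  have d: "disjnt C C'" if "C \<in> P" "C' \<in> P" "C \<noteq> C'" for C C'
    using partition_on_same_block[OF assms(1) that(1,2)] that(3) by (auto simp: disjnt_def)
  have d': "disjnt (insert (Suc n) B) C" if "C \<in> P" "C \<noteq> B" for C
    using d[of B C] that assms partition_on_atLeastAtMostD(6)[OF assms(1) that(1)]
    by (auto simp: disjnt_def)
  show "disjnt C C'" if "C \<in> append_point n P B" "C' \<in> append_point n P B" "C \<noteq> C'" for C C'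
    using that d d' disjnt_sym unfolding append_point_def by blast
qed

text \<open>Deleting \<open>Suc n\<close> from its block undoes the construction. With
  \<open>append_point_inj\<close>, every partition of \<open>{1..Suc n}\<close> arises from exactly
  one pair \<open>P\<close>, \<open>B\<close>.\<close>

lemma append_point_surj:
  assumes "partition_on {1..Suc n} Q"
  obtains P B where "partition_on {1..n} P" "B \<in> insert {} P" "Q = append_point n P B"
proof -
  have U: "\<Union>Q = {1..Suc n}" using assms by (simp add: partition_on_def)
  then have "Suc n \<in> \<Union>Q" by simp
  then obtain C where C: "C \<in> Q" "Suc n \<in> C" by blast
  define B where "B = C - {Suc n}"
  \<comment> \<open>If \<open>C\<close> is the singleton \<open>{Suc n}\<close>, the remainder
    \<open>B\<close> is empty and must not become a block.\<close>
  define P where "P = (Q - {C}) \<union> ({B} - {{}})"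
  have same: "D = C" if "D \<in> Q" "x \<in> D" "x \<in> C" for x D
    using partition_on_same_block[OF assms] that C by blast
  have e: "{} \<notin> Q" using assms by (simp add: partition_on_def)
  \<comment> \<open>If the remainder of \<open>C\<close> were another block of \<open>Q\<close>,
    that block would be lost in \<open>P - {B}\<close> below.\<close>
  have BQ: "B \<notin> Q - {C}"
  proof
    assume "B \<in> Q - {C}"
    moreover obtain x where "x \<in> B" using calculation e by (metis Diff_iff ex_in_conv)
    ultimately show False using same[of B x] by (auto simp: B_def)
  qed
  have "partition_on {1..n} P"
  proof (rule partition_onI)
    have "Suc n \<notin> \<Union>(Q - {C})" using C same by blast
    moreover have "\<Union>P = B \<union> \<Union>(Q - {C})" by (auto simp: P_def)
    moreover have "\<Union>Q = C \<union> \<Union>(Q - {C})" using C by blast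
    ultimately have "\<Union>P = \<Union>Q - {Suc n}" by (simp add: B_def Un_Diff)
    moreover have "{1..Suc n} - {Suc n} = {1..n}" by auto
    ultimately show "\<Union>P = {1..n}" using U by simp
    show "{} \<notin> P" using e by (auto simp: P_def)
    have dB: "disjnt D B" if "D \<in> Q - {C}" for D
      using that same unfolding B_def disjnt_def by blast
    show "disjnt D D'" if "D \<in> P" "D' \<in> P" "D \<noteq> D'" for D D'
    proof (cases "D = B \<or> D' = B")
      case True
      then show ?thesis using that dB[of D] dB[of D'] disjnt_sym unfolding P_def by blast
    next
      case False
      then have "D \<in> Q" "D' \<in> Q" using that by (auto simp: P_def)
      then show ?thesis
        using partition_on_same_block[OF assms] that(3) unfolding disjnt_def by blast
    qed
  qed
  moreover have "B \<in> insert {} P" by (auto simp: P_def)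
  moreover have "Q = append_point n P B"
  proof -
    have "P - {B} = Q - {C}" using BQ e by (auto simp: P_def)
    moreover have "insert (Suc n) B = C" using C by (auto simp: B_def)
    ultimately show ?thesis using C by (auto simp: append_point_def)
  qed
  ultimately show ?thesis using that by blast
qed

text \<open>The block containing \<open>Suc n\<close> determines \<open>B\<close>, the other blocks
  are \<open>P - {B}\<close>, and \<open>B\<close> belongs to \<open>P\<close> exactly when it is
  nonempty.\<close>

lemma append_point_inj:
  assumes P: "partition_on {1..n} P" "B \<in> insert {} P"
    and P': "partition_on {1..n} P'" "B' \<in> insert {} P'"
    and eq: "append_point n P B = append_point n P' B'"
  shows "P = P' \<and> B = B'"
proof -
  have N: "Suc n \<notin> D" if "D \<in> P \<or> D \<in> P'" for D
    using that partition_on_atLeastAtMostD(6) P P' by blast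
  have "insert (Suc n) B = insert (Suc n) B'"
    using eq N unfolding append_point_def by blast
  moreover have nB: "Suc n \<notin> B" "Suc n \<notin> B'" using N P P' by auto
  ultimately have BB: "B = B'" by (metis insert_ident)
  then have "insert (insert (Suc n) B) (P - {B}) = insert (insert (Suc n) B) (P' - {B})"
    using eq by (simp add: append_point_def)
  moreover have "insert (Suc n) B \<notin> P" "insert (Suc n) B \<notin> P'" using N by blast+
  ultimately have D: "P - {B} = P' - {B}" by (metis Diff_iff insert_ident)
  have "B \<in> P \<longleftrightarrow> B \<in> P'"
    using P(2) P'(2) BB partition_on_atLeastAtMostD(7)[OF P(1)] partition_on_atLeastAtMostD(7)[OF P'(1)]
    by auto
  then have "P = P'" using D by (metis Diff_empty Diff_insert0 insert_Diff)
  then show ?thesis using BB by simp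
qed

section \<open>Arcs and blocks under appending\<close>

text \<open>\<open>Suc n\<close> exceeds all elements of \<open>B\<close>, so it separates no
  consecutive elements and its predecessor is \<open>Max B\<close>.\<close>

lemma arcs_append_point:
  assumes "partition_on {1..n} P" "B \<in> insert {} P"
  shows "arcs (append_point n P B) = arcs P \<union> (if B = {} then {} else {(Max B, Suc n)})"
proof -
  have "arcs {insert (Suc n) B} = arcs {B} \<union> (if B = {} then {} else {(Max B, Suc n)})"
  proof (cases "B = {}")
    case True
    then show ?thesis by (auto simp: arcs_def)
  next
    case False
    then have BP: "B \<in> P" using assms by simp
    note D = partition_on_atLeastAtMostD[OF assms(1)]
    have fin: "finite B" using D(2) BP .
    have le: "m \<le> n" if "m \<in> B" for m using D(4)[OF BP] that by auto
    have M: "m \<le> Max B" if "m \<in> B" for m using fin that by simp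
    have Mx: "Max B \<in> B" using D(5) BP .
    have "(i, j) \<in> arcs {insert (Suc n) B} \<longleftrightarrow> (i, j) \<in> arcs {B} \<or> i = Max B \<and> j = Suc n" for i j
    proof (cases "j = Suc n")
      case True
      have "(i, Suc n) \<in> arcs {insert (Suc n) B} \<longleftrightarrow> i \<in> B \<and> (\<forall>m\<in>B. \<not> (i < m))"
        using le by (fastforce simp: arcs_def)
      also have "\<dots> \<longleftrightarrow> i = Max B" using M Mx by (metis leD le_neq_implies_less)
      finally show ?thesis using True le by (fastforce simp: arcs_def)
    next
      case False
      then show ?thesis using le by (fastforce simp: arcs_def)
    qed
    then show ?thesis using False by auto
  qed
  then show ?thesis
    using arcs_split[OF assms(2)] arcs_insert[of "insert (Suc n) B" "P - {B}"]
    by (auto simp: append_point_def)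
qed

lemma arcs_subset:
  assumes "partition_on {1..n} P"
  shows "arcs P \<subseteq> {1..n} \<times> {1..n}"
  using partition_on_atLeastAtMostD(4)[OF assms] by (fastforce simp: arcs_def)

lemma card_append_point:
  assumes "partition_on {1..n} P" "B \<in> insert {} P"
  shows "card (append_point n P B) = (if B = {} then Suc (card P) else card P)"
proof -
  note D = partition_on_atLeastAtMostD[OF assms(1)]
  have "insert (Suc n) B \<notin> P - {B}" using D(6) by blast
  then have "card (append_point n P B) = Suc (card (P - {B}))"
    using D(1) by (simp add: append_point_def)
  also have "\<dots> = (if B = {} then Suc (card P) else card P)"
    using D(1,7) assms(2) card_Suc_Diff1[of P B] by auto
  finally show ?thesis .
qed

text \<open>Each appended point adds either one arc or one block, never both. This trades the number
  of arcs for the number of blocks.\<close>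

lemma card_arcs_plus_card:
  "partition_on {1..n} P \<Longrightarrow> card (arcs P) + card P = n"
proof (induction n arbitrary: P)
  case 0
  then have "P = {}" by (auto simp: partition_on_def)
  then show ?case by simp
next
  case (Suc n)
  obtain P' B where P: "partition_on {1..n} P'" "B \<in> insert {} P'" "P = append_point n P' B"
    using append_point_surj[OF Suc.prems] .
  have "(Max B, Suc n) \<notin> arcs P'" using arcs_subset[OF P(1)] by auto
  moreover have "finite (arcs P')" using arcs_subset[OF P(1)] finite_subset by blast
  ultimately have "card (arcs P) = (if B = {} then card (arcs P') else Suc (card (arcs P')))"
    using arcs_append_point[OF P(1,2)] P(3) by simp
  then show ?case using card_append_point[OF P(1,2)] P(3) Suc.IH[OF P(1)] by simp
qed

section \<open>Ranks of blocks\<close>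

text \<open>Ranks start at 0, for the block with the largest maximum. Counting maxima instead of
  blocks makes the rank comparable with \<open>last_rank\<close>.\<close>

definition block_rank :: "nat set set \<Rightarrow> nat set \<Rightarrow> nat" where
  "block_rank P B = card {m \<in> Max ` P. Max B < m}"

text \<open>The rank at which n was appended, read off from the final partition: the condition m < n
  discards the maximum of the block that n has joined.\<close>

definition last_rank :: "nat \<Rightarrow> nat set set \<Rightarrow> nat" where
  "last_rank n P = card {m \<in> Max ` P. m < n \<and> (\<exists>i. (i, n) \<in> arcs P \<and> i < m)}"

lemma inj_on_Max_partition:
  fixes n :: nat
  assumes "partition_on {1..n} P"
  shows "inj_on Max P"
proof (rule inj_onI)
  fix B C :: "nat set" assume "B \<in> P" "C \<in> P" "Max B = Max C"
  then show "B = C" using partition_on_same_block[OF assms, of B C "Max B"]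
    partition_on_atLeastAtMostD(5)[OF assms] by metis
qed

text \<open>The map is strictly decreasing, hence injective, and its values lie in a set of the same
  size.\<close>

lemma bij_betw_card_greater:
  fixes M :: "'a::linorder set"
  assumes "finite M"
  shows "bij_betw (\<lambda>m. card {m' \<in> M. m < m'}) M {..<card M}"
proof -
  let ?f = "\<lambda>m. card {m' \<in> M. m < m'}"
  have less: "?f m' < ?f m" if "m < m'" "m' \<in> M" for m m'
    by (rule psubset_card_mono) (use assms that in auto)
  have inj: "inj_on ?f M"
    by (rule linorder_inj_onI) (use less in force)+
  have "?f m < card M" if "m \<in> M" for m
    by (rule psubset_card_mono) (use assms that in auto)
  then have "?f ` M \<subseteq> {..<card M}" by auto
  moreover have "card (?f ` M) = card {..<card M}" using inj by (simp add: card_image)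
  ultimately have "?f ` M = {..<card M}" by (intro card_subset_eq) auto
  then show ?thesis using inj by (simp add: bij_betw_def)
qed

text \<open>Distinct blocks have distinct maxima, so choosing a block amounts to choosing a rank
  below \<open>card P\<close>.\<close>

lemma bij_betw_block_rank:
  assumes "partition_on {1..n} P"
  shows "bij_betw (block_rank P) P {..<card P}"
proof -
  have "bij_betw Max P (Max ` P)"
    using inj_on_Max_partition[OF assms] by (simp add: bij_betw_def)
  moreover have "bij_betw (\<lambda>m. card {m' \<in> Max ` P. m < m'}) (Max ` P) {..<card (Max ` P)}"
    using partition_on_atLeastAtMostD(1)[OF assms] by (intro bij_betw_card_greater) simp
  moreover have "card (Max ` P) = card P"
    using inj_on_Max_partition[OF assms] by (rule card_image)
  ultimately have "bij_betw ((\<lambda>m. card {m' \<in> Max ` P. m < m'}) \<circ> Max) P {..<card P}"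
    by (metis bij_betw_trans)
  then show ?thesis by (simp add: block_rank_def[abs_def] comp_def)
qed

text \<open>The only possible arc into \<open>Suc n\<close> starts at \<open>Max B\<close>.
  Appending to a block replaces the maximum \<open>Max B\<close> by \<open>Suc n\<close>, and
  neither of them enters the count.\<close>

lemma last_rank_append_point:
  assumes "partition_on {1..n} P" "B \<in> insert {} P"
  shows "last_rank (Suc n) (append_point n P B) = (if B = {} then 0 else block_rank P B)"
proof -
  have arc: "(i, Suc n) \<in> arcs (append_point n P B) \<longleftrightarrow> B \<noteq> {} \<and> i = Max B" for i
    using arcs_append_point[OF assms] arcs_subset[OF assms(1)] by auto
  show ?thesis
  proof (cases "B = {}")
    case True
    then show ?thesis using arc by (simp add: last_rank_def)
  next
    case False
    note D = partition_on_atLeastAtMostD[OF assms(1)]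
    have BP: "B \<in> P" using False assms(2) by simp
    have ins: "Max (insert (Suc n) B) = Suc n"
      using D(4)[OF BP] D(2)[OF BP] by (intro Max_eqI) auto
    have lt: "Max C < Suc n" if "C \<in> P" for C using D(4,5)[OF that] by force
    have "{m \<in> Max ` append_point n P B. m < Suc n \<and> Max B < m} = {m \<in> Max ` P. Max B < m}"
      using ins lt by (auto simp: append_point_def)
    then show ?thesis using False arc by (simp add: last_rank_def block_rank_def)
  qed
qed

text \<open>If an arc ends at \<open>n\<close>, then \<open>n\<close> is the maximum of a block but
  is left out of the count; otherwise the count is 0 and some block exists.\<close>

lemma last_rank_less:
  assumes "partition_on {1..n} P" "P \<noteq> {}"
  shows "last_rank n P < card P"
proof (cases "\<exists>i. (i, n) \<in> arcs P")
  case False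
  then show ?thesis
    using assms partition_on_atLeastAtMostD(1)[OF assms(1)] by (simp add: last_rank_def card_gt_0_iff)
next
  case True
  note D = partition_on_atLeastAtMostD[OF assms(1)]
  from True obtain B where B: "B \<in> P" "n \<in> B" by (auto simp: arcs_def)
  have "Max B = n" using D(2,4)[OF B(1)] B(2) by (intro Max_eqI) auto
  then have "n \<in> Max ` P" using B by blast
  then have "{m \<in> Max ` P. m < n \<and> (\<exists>i. (i, n) \<in> arcs P \<and> i < m)} \<subset> Max ` P" by blast
  then have "last_rank n P < card (Max ` P)"
    unfolding last_rank_def using D(1) by (intro psubset_card_mono) auto
  then show ?thesis using card_image_le[OF D(1), of Max] by simp
qed

section \<open>Right crossings in terms of ranks\<close>

text \<open>The left side says that an arc \<open>(i, n)\<close> crosses the arc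
  \<open>(Max B, Suc n)\<close> created by appending to \<open>B\<close>. Both ranks count maxima
  above a threshold, \<open>Max B\<close> or \<open>i\<close>, but only \<open>block_rank\<close>
  counts \<open>n\<close> itself; hence the non-strict comparison.\<close>

lemma crossing_condition:
  assumes "partition_on {1..n} P" "B \<in> P"
  shows "(\<exists>i. (i, n) \<in> arcs P \<and> i < Max B \<and> Max B < n) \<longleftrightarrow>
    0 < block_rank P B \<and> block_rank P B \<le> last_rank n P"
proof (cases "\<exists>i. (i, n) \<in> arcs P")
  case False
  then have "last_rank n P = 0" by (simp add: last_rank_def)
  then show ?thesis using False by auto
next
  case True
  note D = partition_on_atLeastAtMostD[OF assms(1)]
  from True obtain i C where i: "(i, n) \<in> arcs P" and C: "C \<in> P" "n \<in> C" "i \<in> C" "i < n"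
    by (auto simp: arcs_def)
  \<comment> \<open>At most one arc ends at \<open>n\<close>, so the existential quantifier in
    \<open>last_rank\<close> refers to this \<open>i\<close> alone.\<close>
  have uniq: "j = i" if j: "(j, n) \<in> arcs P" for j
  proof -
    obtain C' where C': "C' \<in> P" "n \<in> C'" "j \<in> C'" "j < n" "\<forall>m\<in>C'. \<not> (j < m \<and> m < n)"
      using j by (auto simp: arcs_def)
    obtain C'' where C'': "C'' \<in> P" "n \<in> C''" "i \<in> C''" "i < n" "\<forall>m\<in>C''. \<not> (i < m \<and> m < n)"
      using i by (auto simp: arcs_def)
    have "C' = C''" using partition_on_same_block[OF assms(1)] C' C'' by blast
    then show ?thesis using C' C'' by (meson linorder_neqE_nat)
  qed
  let ?M = "Max ` P"
  have fin: "finite ?M" using D(1) by simp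
  have MC: "Max C = n" using D(2,4)[OF C(1)] C(2) by (intro Max_eqI) auto
  then have nM: "n \<in> ?M" using C by blast
  have MB: "Max B \<le> n" using D(4,5)[OF assms(2)] by force
  have iM: "i \<noteq> Max B"
  proof
    assume "i = Max B"
    then have "B = C" using partition_on_same_block[OF assms(1,2) C(1)] D(5)[OF assms(2)] C(3) by metis
    then show False using MC \<open>i = Max B\<close> C(4) by simp
  qed
  have l: "last_rank n P = card {m \<in> ?M. m < n \<and> i < m}"
    unfolding last_rank_def using i uniq by metis
  have le_n: "m \<le> n" if "m \<in> ?M" for m using that D(4,5) by force
  show ?thesis
  proof (cases "Max B = n")
    case True
    have "{m \<in> ?M. Max B < m} = {}" using True le_n by force
    then have "block_rank P B = 0" by (simp only: block_rank_def card.empty)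
    then show ?thesis using True by simp
  next
    case False
    then have Bn: "Max B < n" using MB by simp
    have pos: "0 < block_rank P B"
      unfolding block_rank_def card_gt_0_iff using fin Bn nM by auto
    show ?thesis
    proof (cases "i < Max B")
      case True
      have "Max B \<in> ?M" using assms(2) by blast
      have "{m \<in> ?M. Max B < m} = insert n {m \<in> ?M. m < n \<and> Max B < m}"
        using nM Bn le_n by force
      then have "block_rank P B = Suc (card {m \<in> ?M. m < n \<and> Max B < m})"
        unfolding block_rank_def using fin by simp
      \<comment> \<open>\<open>Max B\<close> lies in the larger set only, which makes up for the
        \<open>Suc\<close> that came from counting \<open>n\<close>.\<close>
      moreover have "card {m \<in> ?M. m < n \<and> Max B < m} < card {m \<in> ?M. m < n \<and> i < m}"
        by (rule psubset_card_mono) (use fin True Bn \<open>Max B \<in> ?M\<close> in auto)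
      ultimately show ?thesis using True Bn pos i l by auto
    next
      case False
      then have "Max B < i" using iM by simp
      then have "card {m \<in> ?M. m < n \<and> i < m} < card {m \<in> ?M. Max B < m}"
        using Bn fin nM by (intro psubset_card_mono) auto
      then have "last_rank n P < block_rank P B" using l by (simp add: block_rank_def)
      then show ?thesis using False uniq by auto
    qed
  qed
qed

text \<open>The new arc ends beyond all old points, so in a right crossing it can only be the second
  arc, and the first must then end at \<open>n\<close>.\<close>

lemma has_right_crossing_append_point:
  assumes "partition_on {1..n} P" "B \<in> insert {} P"
  shows "has_right_crossing (append_point n P B) \<longleftrightarrow> has_right_crossing P \<or>
    B \<noteq> {} \<and> 0 < block_rank P B \<and> block_rank P B \<le> last_rank n P"
proof (cases "B = {}")
  case True
  then show ?thesis using arcs_append_point[OF assms] by (simp add: has_right_crossing_def)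
next
  case False
  then have BP: "B \<in> P" using assms by simp
  have A: "arcs (append_point n P B) = insert (Max B, Suc n) (arcs P)"
    using arcs_append_point[OF assms] False by simp
  have le: "i \<le> n" "j \<le> n" if "(i, j) \<in> arcs P" for i j
    using arcs_subset[OF assms(1)] that by auto
  have "has_right_crossing (append_point n P B) \<longleftrightarrow> has_right_crossing P \<or>
      (\<exists>i. (i, n) \<in> arcs P \<and> i < Max B \<and> Max B < n)"
    unfolding has_right_crossing_def A using le by fastforce
  then show ?thesis using crossing_condition[OF assms(1) BP] False by simp
qed

section \<open>Recurrences for crossing-free partitions\<close>

definition crossing_free :: "nat \<Rightarrow> nat \<Rightarrow> nat set set set" where
  "crossing_free n b = {P. partition_on {1..n} P \<and> card P = b \<and> \<not> has_right_crossing P}"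

text \<open>Appending at rank \<open>q > 0\<close> keeps a partition crossing-free exactly when its
  \<open>last_rank\<close> is below \<open>q\<close>, so the recurrence closes on these cumulative
  sets.\<close>

definition crossing_free_below :: "nat \<Rightarrow> nat \<Rightarrow> nat \<Rightarrow> nat set set set" where
  "crossing_free_below n b q = {P \<in> crossing_free n b. last_rank n P < q}"

lemma finite_crossing_free [simp]: "finite (crossing_free n b)"
proof (rule finite_subset)
  show "crossing_free n b \<subseteq> Pow (Pow {1..n})"
    by (auto simp: crossing_free_def partition_on_def)
qed simp

lemma finite_crossing_free_below [simp]: "finite (crossing_free_below n b q)"
  by (simp add: crossing_free_below_def)

text \<open>At \<open>q = b\<close> the bound holds automatically by \<open>last_rank_less\<close>,
  so the recurrence in \<open>q\<close> ends at the full count.\<close>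

lemma crossing_free_eq_below:
  assumes "0 < b"
  shows "crossing_free n b = crossing_free_below n b b"
  using assms last_rank_less by (fastforce simp: crossing_free_def crossing_free_below_def)

lemma crossing_free_empty: "n < b \<Longrightarrow> crossing_free n b = {}"
  using card_arcs_plus_card by (fastforce simp: crossing_free_def)

lemma crossing_free_below_empty: "n < b \<Longrightarrow> crossing_free_below n b q = {}"
  by (simp add: crossing_free_below_def crossing_free_empty)

lemma crossing_free_Suc_zero [simp]: "crossing_free (Suc n) 0 = {}"
  using partition_on_atLeastAtMostD(1) by (fastforce simp: crossing_free_def partition_on_def)

lemma crossing_free_0_0: "crossing_free 0 0 = {{}}"
  by (auto simp: crossing_free_def partition_on_def disjoint_def has_right_crossing_def)

definition ranked_block :: "nat set set \<Rightarrow> nat \<Rightarrow> nat set" where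
  "ranked_block P q = inv_into P (block_rank P) q"

lemma ranked_block:
  assumes "partition_on {1..n} P" "q < card P"
  shows "ranked_block P q \<in> P" "block_rank P (ranked_block P q) = q"
proof -
  have "q \<in> block_rank P ` P"
    using bij_betw_block_rank[OF assms(1)] assms(2) by (simp add: bij_betw_def)
  then show "ranked_block P q \<in> P" "block_rank P (ranked_block P q) = q"
    unfolding ranked_block_def by (simp_all only: inv_into_into f_inv_into_f)
qed

lemma ranked_block_block_rank:
  assumes "partition_on {1..n} P" "B \<in> P"
  shows "ranked_block P (block_rank P B) = B"
  using bij_betw_block_rank[OF assms(1)] assms(2) unfolding ranked_block_def bij_betw_def
  by (simp add: inv_into_f_f)

lemma block_rank_less:
  assumes "partition_on {1..n} P" "B \<in> P"
  shows "block_rank P B < card P"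
  using bij_betw_block_rank[OF assms(1)] assms(2) by (auto simp: bij_betw_def)

lemma inj_on_append_singleton:
  "inj_on (\<lambda>P. append_point n P {}) {P. partition_on {1..n} P}"
  by (rule inj_onI) (use append_point_inj in blast)

lemma inj_on_append_ranked:
  "inj_on (\<lambda>P. append_point n P (ranked_block P q)) {P. partition_on {1..n} P \<and> q < card P}"
proof (rule inj_onI)
  fix P P' assume P: "P \<in> {P. partition_on {1..n} P \<and> q < card P}"
    "P' \<in> {P. partition_on {1..n} P \<and> q < card P}"
    and e: "append_point n P (ranked_block P q) = append_point n P' (ranked_block P' q)"
  show "P = P'"
    using append_point_inj[OF _ _ _ _ e] P ranked_block(1) by blast
qed

text \<open>Joining the block of rank \<open>q\<close> keeps the number of blocks; opening a
  singleton raises it and gives rank 0. Rank 0 never creates a crossing, while a positive rank must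
  exceed the previous one.\<close>

lemma crossing_free_Suc_cases:
  "{Q \<in> crossing_free (Suc n) (Suc b). last_rank (Suc n) Q = q} =
     (\<lambda>P. append_point n P (ranked_block P q)) ` {P \<in> crossing_free n (Suc b).
        q \<le> b \<and> (q = 0 \<or> last_rank n P < q)} \<union>
     (\<lambda>P. append_point n P {}) ` {P \<in> crossing_free n b. q = 0}" (is "?L = ?R1 \<union> ?R2")
proof (intro equalityI subsetI)
  fix Q assume Q: "Q \<in> ?L"
  then have "partition_on {1..Suc n} Q" by (simp add: crossing_free_def)
  then obtain P B where P: "partition_on {1..n} P" "B \<in> insert {} P" "Q = append_point n P B"
    by (rule append_point_surj)
  note facts = card_append_point[OF P(1,2)] has_right_crossing_append_point[OF P(1,2)]
    last_rank_append_point[OF P(1,2)]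
  show "Q \<in> ?R1 \<union> ?R2"
  proof (cases "B = {}")
    case True
    then show ?thesis using Q P facts by (auto simp: crossing_free_def)
  next
    case False
    then have "B \<in> P" using P by simp
    have r: "block_rank P B = q" using Q P facts False by simp
    then have "B = ranked_block P q" using ranked_block_block_rank[OF P(1) \<open>B \<in> P\<close>] by simp
    moreover have "P \<in> crossing_free n (Suc b)" "q = 0 \<or> last_rank n P < q"
      using Q P facts False r by (auto simp: crossing_free_def)
    moreover have "q \<le> b"
      using block_rank_less[OF P(1) \<open>B \<in> P\<close>] r Q P facts False by (auto simp: crossing_free_def)
    ultimately show ?thesis using P(3) by blast
  qed
next
  fix Q assume "Q \<in> ?R1 \<union> ?R2"
  then show "Q \<in> ?L"
  proof
    assume "Q \<in> ?R1"
    then obtain P where P: "P \<in> crossing_free n (Suc b)" "q \<le> b" "q = 0 \<or> last_rank n P < q"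
      "Q = append_point n P (ranked_block P q)" by blast
    then have p: "partition_on {1..n} P" "q < card P" by (auto simp: crossing_free_def)
    note B = ranked_block[OF p]
    have B': "ranked_block P q \<in> insert {} P" "ranked_block P q \<noteq> {}"
      using B partition_on_atLeastAtMostD(3)[OF p(1)] by auto
    show ?thesis
      using P B B'(2) partition_on_append_point[OF p(1) B'(1)] card_append_point[OF p(1) B'(1)]
        has_right_crossing_append_point[OF p(1) B'(1)] last_rank_append_point[OF p(1) B'(1)]
      by (auto simp: crossing_free_def)
  next
    assume "Q \<in> ?R2"
    then obtain P where P: "P \<in> crossing_free n b" "q = 0" "Q = append_point n P {}" by blast
    then have p: "partition_on {1..n} P" "{} \<in> insert {} P" by (auto simp: crossing_free_def)
    show ?thesis
      using P partition_on_append_point[OF p] card_append_point[OF p]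
        has_right_crossing_append_point[OF p] last_rank_append_point[OF p]
      by (auto simp: crossing_free_def)
  qed
qed

lemma card_last_rank_eq:
  assumes "0 < q" "q \<le> b"
  shows "card {Q \<in> crossing_free (Suc n) (Suc b). last_rank (Suc n) Q = q} =
    card (crossing_free_below n (Suc b) q)"
proof -
  have "{Q \<in> crossing_free (Suc n) (Suc b). last_rank (Suc n) Q = q} =
      (\<lambda>P. append_point n P (ranked_block P q)) ` crossing_free_below n (Suc b) q"
    using assms by (simp add: crossing_free_Suc_cases crossing_free_below_def)
  moreover have "inj_on (\<lambda>P. append_point n P (ranked_block P q)) (crossing_free_below n (Suc b) q)"
    by (rule inj_on_subset[OF inj_on_append_ranked])
      (use assms in \<open>auto simp: crossing_free_below_def crossing_free_def\<close>)
  ultimately show ?thesis by (simp add: card_image)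
qed

lemma card_crossing_free_below_Suc:
  assumes "0 < q" "q \<le> b"
  shows "card (crossing_free_below (Suc n) (Suc b) (Suc q)) =
    card (crossing_free_below (Suc n) (Suc b) q) + card (crossing_free_below n (Suc b) q)"
proof -
  have "crossing_free_below (Suc n) (Suc b) (Suc q) = crossing_free_below (Suc n) (Suc b) q \<union>
      {Q \<in> crossing_free (Suc n) (Suc b). last_rank (Suc n) Q = q}"
    by (auto simp: crossing_free_below_def)
  moreover have "crossing_free_below (Suc n) (Suc b) q \<inter>
      {Q \<in> crossing_free (Suc n) (Suc b). last_rank (Suc n) Q = q} = {}"
    by (auto simp: crossing_free_below_def)
  ultimately show ?thesis using card_last_rank_eq[OF assms] by (simp add: card_Un_disjoint)
qed

text \<open>Rank 0 arises by joining the block of \<open>n\<close> or by opening a singleton;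
  \<open>append_point_inj\<close> tells the two apart.\<close>

lemma card_crossing_free_below_one:
  "card (crossing_free_below (Suc n) (Suc b) 1) =
    card (crossing_free n (Suc b)) + card (crossing_free n b)"
proof -
  let ?f = "\<lambda>P. append_point n P (ranked_block P 0)" and ?g = "\<lambda>P. append_point n P {}"
  have p: "partition_on {1..n} P" "card P = c" if "P \<in> crossing_free n c" for P c
    using that by (auto simp: crossing_free_def)
  have "crossing_free_below (Suc n) (Suc b) 1 =
      ?f ` crossing_free n (Suc b) \<union> ?g ` crossing_free n b"
    using crossing_free_Suc_cases[of n b 0] by (simp add: crossing_free_below_def)
  moreover have "?f ` crossing_free n (Suc b) \<inter> ?g ` crossing_free n b = {}"
  proof -
    have "?f P \<noteq> ?g P'" if P: "P \<in> crossing_free n (Suc b)" and P': "P' \<in> crossing_free n b" for P P'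
    proof
      assume e: "?f P = ?g P'"
      have "ranked_block P 0 \<in> P" using ranked_block(1)[OF p(1)[OF P]] p(2)[OF P] by simp
      then have "ranked_block P 0 = {}"
        using append_point_inj[OF p(1)[OF P] _ p(1)[OF P'] _ e] by blast
      then show False
        using \<open>ranked_block P 0 \<in> P\<close> partition_on_atLeastAtMostD(7)[OF p(1)[OF P]] by simp
    qed
    then show ?thesis by blast
  qed
  moreover have "inj_on ?f (crossing_free n (Suc b))"
    by (rule inj_on_subset[OF inj_on_append_ranked]) (auto dest: p)
  moreover have "inj_on ?g (crossing_free n b)"
    by (rule inj_on_subset[OF inj_on_append_singleton]) (auto dest: p)
  ultimately show ?thesis by (simp add: card_Un_disjoint card_image)
qed

text \<open>By \<open>card_arcs_plus_card\<close>, \<open>k\<close> arcs mean \<open>n - k\<close>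
  blocks; \<open>k \<le> n\<close> keeps the subtraction from truncating.\<close>

lemma CT_eq_card_crossing_free:
  assumes "k \<le> n"
  shows "CT n k = card (crossing_free n (n - k))"
proof -
  have "{P. partition_on {1..n} P \<and> card (arcs P) = k \<and> \<not> has_right_crossing P} =
      crossing_free n (n - k)"
    using card_arcs_plus_card assms by (fastforce simp: crossing_free_def)
  then show ?thesis by (simp add: CT_def)
qed

section \<open>Generating functions\<close>

text \<open>A partition of n points into b blocks has n - b arcs, whence the power of y; where the subtraction
  truncates, the count is 0.\<close>

definition crossing_free_gf :: "nat \<Rightarrow> rat fps fps" where
  "crossing_free_gf b = Abs_fps (\<lambda>n. of_nat (card (crossing_free n b)) * fps_X ^ (n - b))"

definition crossing_free_below_gf :: "nat \<Rightarrow> nat \<Rightarrow> rat fps fps" where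
  "crossing_free_below_gf b q =
     Abs_fps (\<lambda>n. of_nat (card (crossing_free_below n b q)) * fps_X ^ (n - b))"

lemma fps_nth_xy_mult:
  "fps_nth (fps_x * fps_y * f) n = (if n = 0 then 0 else fps_X * fps_nth f (n - 1))"
  by (simp add: mult.assoc)

text \<open>Partitions of last rank exactly \<open>q\<close> come from joining a block, which adds
  one point and one arc; hence the summand with factor xy.\<close>

lemma crossing_free_below_gf_Suc:
  assumes "0 < q" "q \<le> b"
  shows "crossing_free_below_gf (Suc b) (Suc q) =
    (1 + fps_x * fps_y) * crossing_free_below_gf (Suc b) q"
proof (rule fps_ext)
  fix n
  show "fps_nth (crossing_free_below_gf (Suc b) (Suc q)) n =
    fps_nth ((1 + fps_x * fps_y) * crossing_free_below_gf (Suc b) q) n"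
  proof (cases n)
    case 0
    then show ?thesis
      by (simp add: crossing_free_below_gf_def distrib_right fps_nth_xy_mult crossing_free_below_empty)
  next
    case (Suc m)
    show ?thesis
    \<comment> \<open>For \<open>m \<le> b\<close> truncation would spoil the shift of the exponent
      of y, but then no partition of \<open>m\<close> points has \<open>Suc b\<close>
      blocks.\<close>
    proof (cases "m < Suc b")
      case True
      then show ?thesis using card_crossing_free_below_Suc[OF assms, of m] Suc
        by (simp add: crossing_free_below_gf_def distrib_right fps_nth_xy_mult crossing_free_below_empty)
    next
      case False
      then have "Suc m - Suc b = Suc (m - Suc b)" by simp
      then show ?thesis using card_crossing_free_below_Suc[OF assms, of m] Suc
        by (simp add: crossing_free_below_gf_def fps_nth_xy_mult algebra_simps del: diff_Suc_Suc)
    qed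
  qed
qed

text \<open>A new singleton adds a point but no arc, hence x alone; joining the block of rank 0 adds
  both, hence xy.\<close>

lemma crossing_free_below_gf_one:
  "crossing_free_below_gf (Suc b) 1 =
    fps_x * crossing_free_gf b + fps_x * fps_y * crossing_free_gf (Suc b)"
proof (rule fps_ext)
  fix n
  show "fps_nth (crossing_free_below_gf (Suc b) 1) n =
    fps_nth (fps_x * crossing_free_gf b + fps_x * fps_y * crossing_free_gf (Suc b)) n"
  proof (cases n)
    case 0
    then show ?thesis
      by (simp add: crossing_free_below_gf_def fps_nth_xy_mult crossing_free_below_empty)
  next
    case (Suc m)
    show ?thesis
    proof (cases "m < Suc b")
      case True
      then show ?thesis using card_crossing_free_below_one[of m b] Suc
        by (simp add: crossing_free_below_gf_def crossing_free_gf_def fps_nth_xy_mult crossing_free_empty)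
    next
      case False
      then have "m - b = Suc (m - Suc b)" by simp
      then show ?thesis using card_crossing_free_below_one[of m b] Suc
        by (simp add: crossing_free_below_gf_def crossing_free_gf_def fps_nth_xy_mult algebra_simps)
    qed
  qed
qed

lemma crossing_free_below_gf_power:
  "q \<le> b \<Longrightarrow> crossing_free_below_gf (Suc b) (Suc q) =
    (1 + fps_x * fps_y) ^ q * crossing_free_below_gf (Suc b) 1"
  by (induction q) (simp_all add: crossing_free_below_gf_Suc mult.assoc)

text \<open>Running \<open>q\<close> from 1 up to \<open>Suc b\<close> expresses the series for
  \<open>Suc b\<close> blocks through itself and the series for \<open>b\<close> blocks; collecting
  its occurrences gives the factor on the left.\<close>

lemma crossing_free_gf_Suc:
  "crossing_free_gf (Suc b) * (1 - (1 + fps_x * fps_y) ^ b * (fps_x * fps_y)) =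
    fps_x * (1 + fps_x * fps_y) ^ b * crossing_free_gf b"
proof -
  have "crossing_free_gf (Suc b) = crossing_free_below_gf (Suc b) (Suc b)"
    by (simp add: crossing_free_gf_def crossing_free_below_gf_def crossing_free_eq_below)
  also have "\<dots> = (1 + fps_x * fps_y) ^ b *
      (fps_x * crossing_free_gf b + fps_x * fps_y * crossing_free_gf (Suc b))"
    by (simp only: crossing_free_below_gf_power[OF order_refl] crossing_free_below_gf_one)
  finally show ?thesis by (simp add: algebra_simps)
qed

lemma crossing_free_gf_0: "crossing_free_gf 0 = 1"
proof (rule fps_ext)
  fix n show "fps_nth (crossing_free_gf 0) n = fps_nth 1 n"
    by (cases n) (simp_all add: crossing_free_gf_def crossing_free_0_0)
qed

text \<open>Iterating \<open>crossing_free_gf_Suc\<close> accumulates the exponent 0 + 1 + ... + (b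
  - 1), which is \<open>b choose 2\<close>.\<close>

lemma crossing_free_gf_times_denominator:
  "crossing_free_gf b * (\<Prod>k<b. 1 - (1 + fps_x * fps_y) ^ k * (fps_x * fps_y)) =
    fps_x ^ b * (1 + fps_x * fps_y) ^ (b choose 2)"
proof (induction b)
  case 0
  then show ?case by (simp add: crossing_free_gf_0 numeral_2_eq_2)
next
  case (Suc b)
  let ?u = "fps_x * fps_y"
  let ?D = "\<Prod>k<b. 1 - (1 + ?u) ^ k * ?u"
  have "crossing_free_gf (Suc b) * (\<Prod>k<Suc b. 1 - (1 + ?u) ^ k * ?u) =
      crossing_free_gf (Suc b) * (1 - (1 + ?u) ^ b * ?u) * ?D"
    by (simp add: mult_ac)
  also have "\<dots> = fps_x * (1 + ?u) ^ b * (crossing_free_gf b * ?D)"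
    by (simp only: crossing_free_gf_Suc mult.assoc)
  also have "\<dots> = fps_x ^ Suc b * ((1 + ?u) ^ b * (1 + ?u) ^ (b choose 2))"
    by (simp only: Suc.IH) (simp add: mult_ac)
  also have "(1 + ?u) ^ b * (1 + ?u) ^ (b choose 2) = (1 + ?u) ^ (Suc b choose 2)"
    by (simp add: numeral_2_eq_2 power_add)
  finally show ?case .
qed

lemma crossing_free_gf_eq:
  assumes "1 \<le> b"
  shows "crossing_free_gf b = fps_x ^ b * (1 + fps_x * fps_y) ^ (b choose 2)
            / (\<Prod>k=0..b-1. (1 - (1 + fps_x * fps_y) ^ k * (fps_x * fps_y)))"
proof -
  let ?D = "\<Prod>k=0..b-1. (1 - (1 + fps_x * fps_y) ^ k * (fps_x * fps_y))"
  let ?N = "fps_x ^ b * (1 + fps_x * fps_y) ^ (b choose 2)"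
  have "{0..b-1} = {..<b}" using assms by auto
  then have "crossing_free_gf b * ?D = ?N"
    using crossing_free_gf_times_denominator[of b] by simp
  \<comment> \<open>The denominator has constant coefficient 1 in x, so this is a genuine quotient
    and the common factor can be cancelled.\<close>
  also have "?N = ?N / ?D * ?D"
    using divide_times_cancel_const_one[OF denominator_const_one] by simp
  finally have "crossing_free_gf b * ?D = ?N / ?D * ?D" .
  moreover have "?D \<noteq> 0" using denominator_const_one[of b] by (metis fps_zero_nth zero_neq_one)
  ultimately show ?thesis by (metis mult_right_cancel)
qed

section \<open>Infinite sums and comparison of coefficients\<close>

text \<open>Coefficient \<open>m\<close> of a finite partial sum is final once the sum includes all
  indices of \<open>A\<close> up to \<open>m\<close>, which is x-adic convergence.\<close>

lemma has_sum_fps: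
  fixes f :: "nat \<Rightarrow> 'a::comm_ring_1 fps"
  assumes "\<And>n m. n \<in> A \<Longrightarrow> m < n \<Longrightarrow> fps_nth (f n) m = 0"
  shows "(f has_sum Abs_fps (\<lambda>m. \<Sum>n\<in>A \<inter> {..m}. fps_nth (f n) m)) A"
  unfolding has_sum_def
proof (rule tendsto_fpsI)
  fix m
  have "fps_nth (sum f X) m = (\<Sum>n\<in>A \<inter> {..m}. fps_nth (f n) m)"
    if "finite X" "A \<inter> {..m} \<subseteq> X" "X \<subseteq> A" for X
    unfolding fps_sum_nth
  proof (rule sum.mono_neutral_right)
    show "\<forall>i\<in>X - A \<inter> {..m}. fps_nth (f i) m = 0"
      using that(3) assms by (metis Diff_iff IntI atMost_iff not_le subsetD)
  qed (use that in auto)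
  then show "\<forall>\<^sub>F X in finite_subsets_at_top A. fps_nth (sum f X) m =
      fps_nth (Abs_fps (\<lambda>m. \<Sum>n\<in>A \<inter> {..m}. fps_nth (f n) m)) m"
    unfolding eventually_finite_subsets_at_top by (intro exI[of _ "A \<inter> {..m}"]) auto
qed

lemma fps_nth_crossing_free_polynomial:
  "fps_nth (\<Sum>k=0..n-1. of_nat (CT n k) * fps_x ^ n * fps_y ^ k) m =
    (if m = n then \<Sum>k=0..n-1. of_nat (CT n k) * fps_X ^ k else 0)"
proof -
  have "fps_nth (of_nat c * fps_x ^ n * fps_y ^ k) m = (if m = n then of_nat c * fps_X ^ k else 0)"
    for c k
  proof -
    \<comment> \<open>Powers of \<open>fps_y\<close> are constants with respect to x, so the term is
      a monomial in x.\<close>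
    have "of_nat c * fps_x ^ n * fps_y ^ k = fps_const (of_nat c * fps_X ^ k) * fps_x ^ n"
      by (simp add: fps_of_nat[symmetric] fps_const_power mult_ac flip: fps_const_mult)
    then show ?thesis by simp
  qed
  then show ?thesis by (simp add: fps_sum_nth)
qed

theorem theorem1p2:
  shows "(\<lambda>n. \<Sum>k=0..n-1. of_nat (CT n k) * fps_x ^ n * fps_y ^ k) summable_on {1..}
    \<and> (\<lambda>n. fps_x ^ n * (1 + fps_x * fps_y) ^ (n choose 2)
            / (\<Prod>k=0..n-1. (1 - (1 + fps_x * fps_y) ^ k * (fps_x * fps_y)))) summable_on {1..}
    \<and> (\<Sum>\<^sub>\<infinity>n\<in>{1..}. \<Sum>k=0..n-1. of_nat (CT n k) * fps_x ^ n * fps_y ^ k)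
      = (\<Sum>\<^sub>\<infinity>n\<in>{1..}. fps_x ^ n * (1 + fps_x * fps_y) ^ (n choose 2)
            / (\<Prod>k=0..n-1. (1 - (1 + fps_x * fps_y) ^ k * (fps_x * fps_y))))"
    (is "?f summable_on _ \<and> ?g summable_on _ \<and> _")
proof -
  have f: "(?f has_sum Abs_fps (\<lambda>m. \<Sum>n\<in>{1..} \<inter> {..m}. fps_nth (?f n) m)) {1..}"
    by (rule has_sum_fps) (simp only: fps_nth_crossing_free_polynomial, simp)
  have gf: "(crossing_free_gf has_sum
      Abs_fps (\<lambda>m. \<Sum>b\<in>{1..} \<inter> {..m}. fps_nth (crossing_free_gf b) m)) {1..}"
    by (rule has_sum_fps) (simp add: crossing_free_gf_def crossing_free_empty)
  have "(\<Sum>n\<in>{1..} \<inter> {..m}. fps_nth (?f n) m) =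
      (\<Sum>b\<in>{1..} \<inter> {..m}. fps_nth (crossing_free_gf b) m)" for m
  \<comment> \<open>Degree 0 is separate: \<open>{0..m-1}\<close> would still contain 0 by
    truncation, while \<open>{1..m}\<close> is empty.\<close>
  proof (cases "m = 0")
    case True
    have "{1..} \<inter> {..0} = ({} :: nat set)" by auto
    then show ?thesis using True by simp
  next
    case False
    have I: "{1..} \<inter> {..m} = {1..m}" by auto
    have "(\<Sum>n\<in>{1..m}. fps_nth (?f n) m) = (\<Sum>k=0..m-1. of_nat (CT m k) * fps_X ^ k)"
      unfolding fps_nth_crossing_free_polynomial using False by simp
    also have "\<dots> = (\<Sum>b\<in>{1..m}. fps_nth (crossing_free_gf b) m)"
      \<comment> \<open>A partition of \<open>m\<close> points with \<open>k\<close> arcs has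
        \<open>m - k\<close> blocks, so \<open>k\<close> in \<open>{0..m-1}\<close> matches
        \<open>b\<close> in \<open>{1..m}\<close>.\<close>
      by (rule sum.reindex_bij_witness[of _ "\<lambda>b. m - b" "\<lambda>k. m - k"])
        (use False in \<open>auto simp: crossing_free_gf_def CT_eq_card_crossing_free\<close>)
    finally show ?thesis by (simp only: I)
  qed
  then have f': "(?f has_sum
      Abs_fps (\<lambda>m. \<Sum>b\<in>{1..} \<inter> {..m}. fps_nth (crossing_free_gf b) m)) {1..}"
    using f by (simp only:)
  \<comment> \<open>For \<open>b \<ge> 1\<close> the terms on the right are the series
    \<open>crossing_free_gf b\<close>, so both families have the same sum.\<close>
  have g: "(?g has_sum
      Abs_fps (\<lambda>m. \<Sum>b\<in>{1..} \<inter> {..m}. fps_nth (crossing_free_gf b) m)) {1..}"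
    using gf by (rule has_sum_cong[THEN iffD1, rotated]) (simp add: crossing_free_gf_eq)
  show ?thesis
    using f' g by (simp only: has_sum_imp_summable infsumI simp_thms)
qed

end
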